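(* Let $q\in M_n(\mathbb{C})$ be a nontrivial idempotent (i.e. $q^2=q$, $q\ne 0$, $q\neq \mathrm{id}$). If $\dim\big(\{[q]\}'\cap D_n\big)>1$, then there exists an idempotent $r\in M_n(\mathbb{C})$ such that (i) $E(r)=E(q)$; (ii) $\{[r]\}'\cap D_n\subsetneq\{[q]\}'\cap D_n$; (iii) there is a piecewise affine path consisting of at most two affine steps from $q$ to $r$ within the set of idempotents of $M_n(\mathbb{C})$ whose diagonal is equal to $E(q)$.
   Context: $D_n\subset M_n(\mathbb{C})$ is the algebra of diagonal matrices, and $E\colon M_n(\mathbb{C})\to D_n$ is the linear map that keeps the diagonal entries and replaces all off-diagonal entries by $0$. For an idempotent $q$, $[q]$ denotes its range projection, i.e. the orthogonal projection onto the range of $q$. For a matrix $x$, $\{x\}'$ denotes its commutant, the set of matrices commuting with $x$. *)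

theory Defs
  imports "HOL-Analysis.Analysis"
begin

definition mat_smult :: "complex \<Rightarrow> complex ^ 'n ^ 'n \<Rightarrow> complex ^ 'n ^ 'n" where
  "mat_smult c A = (\<chi> i j. c * A $ i $ j)"

text \<open>The library constant \<open>dim\<close>, at type \<^typ>\<open>complex ^ 'n ^ 'n\<close>, is the dimension over the reals;
  the interpretation makes \<open>cmat.dim\<close> the dimension over the complex numbers.\<close>

global_interpretation cmat: vector_space "mat_smult :: complex \<Rightarrow> complex ^ 'n ^ 'n \<Rightarrow> complex ^ 'n ^ 'n"
  by unfold_locales (simp_all add: mat_smult_def vec_eq_iff algebra_simps)

definition idempotents :: "(complex ^ 'n ^ 'n) set" where
  "idempotents = {q. q ** q = q}"

definition diagonal_matrices :: "(complex ^ 'n ^ 'n) set" where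
  "diagonal_matrices = {A. \<forall>i j. i \<noteq> j \<longrightarrow> A $ i $ j = 0}"

definition diag_part :: "complex ^ 'n ^ 'n \<Rightarrow> complex ^ 'n ^ 'n" where
  "diag_part A = (\<chi> i j. if i = j then A $ i $ j else 0)"

definition commutant :: "complex ^ 'n ^ 'n \<Rightarrow> (complex ^ 'n ^ 'n) set" where
  "commutant A = {B. A ** B = B ** A}"

definition conj_transpose :: "complex ^ 'n ^ 'n \<Rightarrow> complex ^ 'n ^ 'n" where
  "conj_transpose A = (\<chi> i j. cnj (A $ j $ i))"

text \<open>Orthogonality refers to the Hermitian inner product: an orthogonal projection is a
  self-adjoint idempotent.  Such a projection is determined by its range; see
  \<open>range_projection_ex1\<close> below.\<close>

definition orthogonal_projection_onto :: "complex ^ 'n ^ 'n \<Rightarrow> (complex ^ 'n) set \<Rightarrow> bool" where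
  "orthogonal_projection_onto p S \<longleftrightarrow>
     p ** p = p \<and> conj_transpose p = p \<and> range ((*v) p) = S"

definition range_projection :: "complex ^ 'n ^ 'n \<Rightarrow> complex ^ 'n ^ 'n" where
  "range_projection q = (THE p. orthogonal_projection_onto p (range ((*v) q)))"

lemma conj_transpose_mult: "conj_transpose (A ** B) = conj_transpose B ** conj_transpose A"
  by (simp add: conj_transpose_def matrix_matrix_mult_def vec_eq_iff mult.commute)

lemma orthogonal_projection_onto_unique:
  assumes "orthogonal_projection_onto p S" "orthogonal_projection_onto p' S"
  shows "p = p'"
proof -
  have absorb: "a ** b = b"
    if a: "orthogonal_projection_onto a S" and b: "orthogonal_projection_onto b S" for a b
  proof -
    have "a *v (b *v x) = b *v x" for x
    proof -
      have "b *v x \<in> range ((*v) a)"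
        using a b by (auto simp: orthogonal_projection_onto_def)
      then obtain y where "b *v x = a *v y" by blast
      then show ?thesis
        using a by (simp add: orthogonal_projection_onto_def matrix_vector_mul_assoc)
    qed
    then show ?thesis
      by (simp add: matrix_eq matrix_vector_mul_assoc)
  qed
  have "p = conj_transpose (p' ** p)"
    using absorb[OF assms(2,1)] assms by (simp add: orthogonal_projection_onto_def)
  also have "\<dots> = p ** p'"
    using assms by (simp add: conj_transpose_mult orthogonal_projection_onto_def)
  also have "\<dots> = p'" by (rule absorb[OF assms])
  finally show ?thesis .
qed

lemma orthogonal_projection_onto_ex:
  fixes q :: "complex ^ 'n ^ 'n"
  shows "\<exists>p. orthogonal_projection_onto p (range ((*v) q))"
proof -
  define S where "S = range ((*v) q)"
  define h :: "complex ^ 'n \<Rightarrow> complex ^ 'n \<Rightarrow> complex"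
    where "h x y = (\<Sum>i\<in>UNIV. x $ i * cnj (y $ i))" for x y
  have h_add: "h (x + y) z = h x z + h y z" "h z (x + y) = h z x + h z y" for x y z
    by (simp_all add: h_def algebra_simps sum.distrib)
  have h_scale: "h (c *s x) z = c * h x z" "h z (c *s x) = cnj c * h z x" for c x z
    by (simp_all add: h_def sum_distrib_left algebra_simps)
  have h_cnj: "h y x = cnj (h x y)" for x y
    by (simp add: h_def mult.commute)
  have Re_h: "Re (h x y) = x \<bullet> y" for x y
    by (simp add: h_def inner_vec_def inner_complex_def)
  have h_self: "x = 0" if "h x x = 0" for x
    using Re_h[of x x] that by simp
  have S_iff: "x \<in> S \<longleftrightarrow> (\<exists>u. x = q *v u)" for x
    by (auto simp: S_def)
  have S_0: "0 \<in> S"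
    unfolding S_iff by (rule exI[of _ 0]) simp
  have S_add: "x + y \<in> S" if "x \<in> S" "y \<in> S" for x y
    using that unfolding S_iff by (metis matrix_vector_right_distrib)
  have S_scale: "c *s x \<in> S" if "x \<in> S" for c x
    using that unfolding S_iff by (metis vector_scalar_commute)
  have S_diff: "x - y \<in> S" if "x \<in> S" "y \<in> S" for x y
    using that unfolding S_iff by (metis matrix_vector_mult_diff_distrib)
  have scaleR_eq: "r *\<^sub>R x = complex_of_real r *s x" for r and x :: "complex ^ 'n"
    by (simp add: vec_eq_iff scaleR_conv_of_real[where 'a=complex])
  have subS: "subspace S"
    unfolding subspace_def scaleR_eq
    using S_add S_scale S_0 by blast
  have ex: "\<exists>y. y \<in> S \<and> (\<forall>w\<in>S. h (x - y) w = 0)" for x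
  proof -
    obtain y z where y: "y \<in> span S" and z: "\<And>w. w \<in> span S \<Longrightarrow> orthogonal z w"
      and x: "x = y + z"
      using orthogonal_subspace_decomp_exists[of S x] by metis
    have sp: "span S = S" using subS by simp
    have "h z w = 0" if w: "w \<in> S" for w
    proof -
      have "Re (h z w) = 0" using z w sp by (simp add: Re_h orthogonal_def)
      moreover have "Re (h z (\<i> *s w)) = 0"
        using z S_scale[OF w] sp by (simp add: Re_h orthogonal_def)
      ultimately show ?thesis by (simp add: h_scale complex_eq_iff)
    qed
    then show ?thesis using y sp x by auto
  qed
  have uniq: "y = y'"
    if "y \<in> S" "\<forall>w\<in>S. h (x - y) w = 0" "y' \<in> S" "\<forall>w\<in>S. h (x - y') w = 0" for x y y'
  proof -
    have "h (y - y') w = 0" if "w \<in> S" for w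
      using h_add(1)[of "y - y'" "x - y" w] that \<open>\<forall>w\<in>S. h (x - y) w = 0\<close>
        \<open>\<forall>w\<in>S. h (x - y') w = 0\<close> by simp
    then show ?thesis using S_diff[OF that(1,3)] h_self by fastforce
  qed
  obtain f where fS: "\<And>x. f x \<in> S" and fo: "\<And>x w. w \<in> S \<Longrightarrow> h (x - f x) w = 0"
    using ex by metis
  have f_eq: "f x = y" if "y \<in> S" "\<And>w. w \<in> S \<Longrightarrow> h (x - y) w = 0" for x y
    using uniq[of "f x" x y] fS fo that by blast
  have f_add: "f (x + y) = f x + f y" for x y
  proof (rule f_eq)
    fix w assume "w \<in> S"
    then show "h (x + y - (f x + f y)) w = 0"
      using h_add(1)[of "x - f x" "y - f y" w] fo by (simp add: algebra_simps)
  qed (simp add: S_add fS)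
  have f_scale: "f (c *s x) = c *s f x" for c x
  proof (rule f_eq)
    fix w assume "w \<in> S"
    then show "h (c *s x - c *s f x) w = 0"
      using fo h_scale(1)[of c "x - f x" w] by (simp add: vec.scale_right_diff_distrib)
  qed (simp add: S_scale fS)
  have "Vector_Spaces.linear (*s) (*s) f"
    by unfold_locales (simp_all add: f_add f_scale)
  then have P: "matrix f *v x = f x" for x by (rule matrix_works)
  have f_id: "f x = x" if "x \<in> S" for x
    by (rule f_eq) (use that in \<open>simp_all add: h_def\<close>)
  have "matrix f ** matrix f = matrix f"
    unfolding matrix_eq matrix_vector_mul_assoc[symmetric] P by (simp add: f_id fS)
  moreover have "range ((*v) (matrix f)) = S"
  proof (intro equalityI subsetI)
    fix x assume "x \<in> S"
    then have "x = matrix f *v x" by (simp add: P f_id)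
    then show "x \<in> range ((*v) (matrix f))" by blast
  qed (auto simp: P fS)
  moreover have "conj_transpose (matrix f) = matrix f"
  proof -
    have sym: "h (f x) y = h x (f y)" for x y
    proof -
      have "h (f x) y = h (f x) (f y) + cnj (h (y - f y) (f x))"
        using h_add(2)[of "f x" "f y" "y - f y"] h_cnj[of "f x" "y - f y"] by simp
      moreover have "h x (f y) = h (f x) (f y) + h (x - f x) (f y)"
        using h_add(1)[of "f x" "x - f x" "f y"] by simp
      ultimately show ?thesis using fo fS by simp
    qed
    have h_axis1: "h x (axis i 1) = x $ i" for x i
    proof -
      have "x $ k * cnj (axis i 1 $ k) = (if k = i then x $ i else 0)" for k
        by (simp add: axis_def)
      then show ?thesis by (simp add: h_def)
    qed
    have M: "matrix f $ i $ j = f (axis j 1) $ i" for i j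
      by (simp add: matrix_def)
    have "cnj (matrix f $ j $ i) = matrix f $ i $ j" for i j
    proof -
      have "matrix f $ i $ j = h (f (axis j 1)) (axis i 1)"
        unfolding M h_axis1 ..
      also have "\<dots> = cnj (h (f (axis i 1)) (axis j 1))"
        unfolding h_cnj[symmetric] by (rule sym)
      also have "\<dots> = cnj (matrix f $ j $ i)"
        unfolding M h_axis1 ..
      finally show ?thesis ..
    qed
    then show ?thesis
      by (simp add: conj_transpose_def vec_eq_iff)
  qed
  ultimately show ?thesis
    unfolding orthogonal_projection_onto_def S_def by blast
qed

lemma range_projection_ex1:
  fixes q :: "complex ^ 'n ^ 'n"
  shows "\<exists>!p. orthogonal_projection_onto p (range ((*v) q))"
  by (rule ex_ex1I[OF orthogonal_projection_onto_ex]) (rule orthogonal_projection_onto_unique)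

end

theory Submission
  imports Defs
begin

text \<open>
  A diagonal matrix \<open>D\<close> commutes with \<open>[q]\<close> iff both \<open>D\<close> and its adjoint leave the range of \<open>q\<close>
  invariant, where invariance means \<open>D q = q D q\<close>.  If the space of such \<open>D\<close> has dimension at
  least two, it contains a diagonal projection \<open>e \<noteq> 0, 1\<close>.  Put \<open>f = 1 - e\<close>.  The first affine
  step goes from \<open>q\<close> to its pinching \<open>p = e q e + f q f\<close>, an idempotent with the range and the
  diagonal of \<open>q\<close>.  The second goes to \<open>r = p + N\<close>, where \<open>N = f (1 - p) Y p e\<close> has zero diagonal,
  \<open>p N = 0\<close> and \<open>N p = N\<close>.  For a diagonal \<open>D\<close> leaving the range of \<open>r\<close> invariant, the diagonal
  blocks of \<open>D r = r D r\<close> give \<open>D p = p D p\<close>, so \<open>D\<close> leaves the range of \<open>q\<close> invariant; and \<open>e\<close>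
  leaves the range of \<open>r\<close> invariant only if \<open>N = 0\<close>.  Some \<open>Y\<close> makes \<open>N \<noteq> 0\<close>, possibly after
  exchanging \<open>e\<close> and \<open>f\<close>.
\<close>

subsection \<open>Matrix algebra\<close>

lemma matrix_diff_ldistrib: "A ** (B - C) = A ** B - A ** (C :: 'a::ring_1 ^ 'n ^ 'm)"
  by (simp add: matrix_matrix_mult_def vec_eq_iff sum_subtractf right_diff_distrib)

lemma matrix_diff_rdistrib: "(A - B) ** C = A ** C - B ** (C :: 'a::ring_1 ^ 'n ^ 'm)"
  by (simp add: matrix_matrix_mult_def vec_eq_iff sum_subtractf left_diff_distrib)

lemma matrix_plus_rdistrib: "(A + B) ** C = A ** C + B ** (C :: 'a::ring_1 ^ 'n ^ 'm)"
  by (simp add: matrix_matrix_mult_def vec_eq_iff sum.distrib distrib_right)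

lemma matrix_zero_left: "0 ** A = (0 :: 'a::ring_1 ^ 'n ^ 'm)"
  by (simp add: matrix_matrix_mult_def vec_eq_iff)

lemma matrix_zero_right: "A ** 0 = (0 :: 'a::ring_1 ^ 'n ^ 'm)"
  by (simp add: matrix_matrix_mult_def vec_eq_iff)

lemmas matrix_ring_simps = matrix_mul_assoc[symmetric] matrix_add_ldistrib matrix_plus_rdistrib
  matrix_diff_ldistrib matrix_diff_rdistrib matrix_zero_left matrix_zero_right

text \<open>Products are simplified in right-nested form; this version of an equation
  \<open>A ** B = C\<close> still matches when a further factor follows.\<close>

lemma matrix_mul_eq_assoc:
  fixes A B C :: "'a::comm_ring_1 ^ 'n ^ 'n"
  assumes "A ** B = C"
  shows "A ** (B ** W) = C ** W"
  using assms by (simp add: matrix_mul_assoc)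

text \<open>A matrix unit \<open>Y\<close> joins a nonzero column of \<open>A\<close> to a nonzero
  row of \<open>B\<close>.\<close>

lemma matrix_sandwich_nonzero:
  fixes A B :: "'a::field ^ 'n ^ 'n"
  assumes "A \<noteq> 0" "B \<noteq> 0"
  shows "\<exists>Y. A ** Y ** B \<noteq> 0"
proof -
  obtain i j where ij: "A $ i $ j \<noteq> 0" using assms(1) by (auto simp: vec_eq_iff)
  obtain k l where kl: "B $ k $ l \<noteq> 0" using assms(2) by (auto simp: vec_eq_iff)
  define Y :: "'a ^ 'n ^ 'n" where "Y = (\<chi> a b. if a = j then if b = k then 1 else 0 else 0)"
  have AY: "(A ** Y) $ i $ b = (if b = k then A $ i $ j else 0)" for b
    by (simp add: matrix_matrix_mult_def Y_def if_distrib cong: if_cong)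
  have "(A ** Y ** B) $ i $ l = (\<Sum>b\<in>UNIV. (A ** Y) $ i $ b * B $ b $ l)"
    by (simp add: matrix_matrix_mult_def)
  also have "\<dots> = (\<Sum>b\<in>UNIV. if b = k then A $ i $ j * B $ k $ l else 0)"
    unfolding AY by (rule sum.cong) auto
  also have "\<dots> = A $ i $ j * B $ k $ l" by simp
  finally have "(A ** Y ** B) $ i $ l \<noteq> 0" using ij kl by simp
  then show ?thesis by (metis zero_index)
qed

lemma diagonal_mult_left:
  assumes "D \<in> diagonal_matrices"
  shows "(D ** A) $ i $ j = D $ i $ i * A $ i $ j"
proof -
  have "(\<Sum>k\<in>UNIV. D $ i $ k * A $ k $ j) = (\<Sum>k\<in>UNIV. if k = i then D $ i $ i * A $ i $ j else 0)"
    using assms by (intro sum.cong) (auto simp: diagonal_matrices_def)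
  then show ?thesis by (simp add: matrix_matrix_mult_def)
qed

lemma diagonal_mult_right:
  assumes "D \<in> diagonal_matrices"
  shows "(A ** D) $ i $ j = A $ i $ j * D $ j $ j"
proof -
  have "(\<Sum>k\<in>UNIV. A $ i $ k * D $ k $ j) = (\<Sum>k\<in>UNIV. if k = j then A $ i $ j * D $ j $ j else 0)"
    using assms by (intro sum.cong) (auto simp: diagonal_matrices_def)
  then show ?thesis by (simp add: matrix_matrix_mult_def)
qed

lemma diagonal_matrices_commute:
  assumes "D \<in> diagonal_matrices" "e \<in> diagonal_matrices"
  shows "D ** e = e ** D"
proof -
  have "D $ i $ i * e $ i $ j = e $ i $ j * D $ j $ j" for i j
    using assms(2) by (cases "i = j") (auto simp: diagonal_matrices_def)
  then show ?thesis
    by (simp add: vec_eq_iff diagonal_mult_left[OF assms(1)] diagonal_mult_right[OF assms(1)])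
qed

lemma conj_transpose_involution [simp]: "conj_transpose (conj_transpose A) = A"
  by (simp add: conj_transpose_def vec_eq_iff)

lemma conj_transpose_diagonal:
  "D \<in> diagonal_matrices \<Longrightarrow> conj_transpose D \<in> diagonal_matrices"
  by (auto simp: conj_transpose_def diagonal_matrices_def)

subsection \<open>Affine segments of idempotents\<close>

text \<open>The hypothesis \<open>anti\<close> says that \<open>p - r\<close> squares to zero, and
  \<open>s - s ** s\<close> is \<open>u * (1 - u)\<close> times that square.\<close>

lemma segment_idempotents:
  assumes p: "p \<in> idempotents" and r: "r \<in> idempotents"
    and anti: "p ** r + r ** p = p + r"
    and diag: "diag_part r = diag_part p"
  shows "path_image (linepath p r) \<subseteq> {s \<in> idempotents. diag_part s = diag_part p}"
proof
  fix s assume "s \<in> path_image (linepath p r)"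
  then obtain u where s: "s = (1 - u) *\<^sub>R p + u *\<^sub>R r"
    by (auto simp: closed_segment_def)
  have pp: "p ** p = p" and rr: "r ** r = r"
    using p r by (auto simp: idempotents_def)
  have rp: "r ** p = p + r - p ** r" using anti by (simp add: algebra_simps)
  have "s ** s = s"
    unfolding s
    by (simp add: matrix_add_ldistrib matrix_plus_rdistrib scalar_matrix_assoc[symmetric]
        matrix_scalar_ac pp rr rp) (simp add: algebra_simps)
  moreover have "diag_part s = diag_part p"
  proof -
    have "r $ i $ i = p $ i $ i" for i
      using diag by (simp add: diag_part_def vec_eq_iff) metis
    then show ?thesis
      unfolding s by (simp add: diag_part_def vec_eq_iff algebra_simps)
  qed
  ultimately show "s \<in> {s \<in> idempotents. diag_part s = diag_part p}"
    by (simp add: idempotents_def)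
qed

subsection \<open>The commutant of a range projection\<close>

lemma range_projection_props:
  fixes q :: "complex ^ 'n ^ 'n"
  assumes "q \<in> idempotents"
  defines "P \<equiv> range_projection q"
  shows "P ** P = P" "conj_transpose P = P" "P ** q = q" "q ** P = P"
proof -
  have "orthogonal_projection_onto P (range ((*v) q))"
    unfolding P_def range_projection_def by (rule theI'[OF range_projection_ex1])
  then have PP: "P ** P = P" and Pc: "conj_transpose P = P"
    and rg: "range ((*v) P) = range ((*v) q)"
    by (auto simp: orthogonal_projection_onto_def)
  have absorb: "a ** b = b"
    if aa: "a ** a = a" and sub: "range ((*v) b) \<subseteq> range ((*v) a)"
    for a b :: "complex ^ 'n ^ 'n"
  proof -
    have "a *v (b *v x) = b *v x" for x
    proof -
      obtain y where "b *v x = a *v y" using sub by blast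
      then show ?thesis using aa by (simp add: matrix_vector_mul_assoc)
    qed
    then show ?thesis by (simp add: matrix_eq matrix_vector_mul_assoc)
  qed
  show "P ** P = P" "conj_transpose P = P" by fact+
  show "P ** q = q" using absorb[OF PP] rg by simp
  show "q ** P = P" using absorb[of q P] assms(1) rg by (simp add: idempotents_def)
qed

text \<open>\<open>q\<close> and its range projection absorb each other, so either can test
  invariance of the common range. As the projection is self-adjoint, taking adjoints turns the
  condition on \<open>conj_transpose D\<close> into invariance of the orthogonal complement under
  \<open>D\<close>.\<close>

lemma commutant_range_projection_iff:
  assumes q: "q \<in> idempotents"
  shows "D \<in> commutant (range_projection q) \<longleftrightarrow>
    D ** q = q ** D ** q \<and> conj_transpose D ** q = q ** conj_transpose D ** q"
proof -
  define P where "P = range_projection q"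
  note P = range_projection_props[OF q, folded P_def]
  have inv: "A ** q = q ** A ** q \<longleftrightarrow> A ** P = P ** A ** P" for A
    by (metis P(1,3,4) matrix_mul_assoc)
  have comm: "P ** D = D ** P \<longleftrightarrow>
      D ** P = P ** D ** P \<and> conj_transpose D ** P = P ** conj_transpose D ** P"
  proof
    assume c: "P ** D = D ** P"
    then have "conj_transpose (P ** D) = conj_transpose (D ** P)" by simp
    then have "conj_transpose D ** P = P ** conj_transpose D"
      by (simp add: conj_transpose_mult P(2))
    with c show "D ** P = P ** D ** P \<and> conj_transpose D ** P = P ** conj_transpose D ** P"
      by (metis P(1) matrix_mul_assoc)
  next
    assume a: "D ** P = P ** D ** P \<and> conj_transpose D ** P = P ** conj_transpose D ** P"
    then have "conj_transpose (conj_transpose D ** P) = conj_transpose (P ** conj_transpose D ** P)"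
      by simp
    then have "P ** D = P ** D ** P"
      by (simp add: conj_transpose_mult P(2) matrix_mul_assoc)
    with a show "P ** D = D ** P" by simp
  qed
  show ?thesis
    unfolding inv using comm by (simp add: commutant_def P_def)
qed

lemma diagonal_dim_gt_1_obtains_projection:
  fixes P :: "complex ^ 'n ^ 'n"
  assumes "cmat.dim (commutant P \<inter> diagonal_matrices) > 1"
  obtains e where "e \<in> commutant P" "e \<in> diagonal_matrices" "e ** e = e"
    "e \<noteq> 0" "e \<noteq> mat 1"
proof -
  have "\<exists>D \<in> commutant P \<inter> diagonal_matrices. \<exists>i j. D $ i $ i \<noteq> D $ j $ j"
  proof (rule ccontr)
    assume none: "\<not> ?thesis"
    have const: "D $ i $ i = D $ j $ j" if "D \<in> commutant P \<inter> diagonal_matrices" for D i j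
      using none that by blast
    have "commutant P \<inter> diagonal_matrices \<subseteq> cmat.span {mat 1}"
    proof
      fix D assume D: "D \<in> commutant P \<inter> diagonal_matrices"
      \<comment> \<open>\<open>undefined\<close> is an arbitrary index: the diagonal of
        \<open>D\<close> is constant.\<close>
      have "D $ i $ j = mat_smult (D $ undefined $ undefined) (mat 1) $ i $ j" for i j
        using D const[OF D, of i undefined]
        by (cases "i = j") (simp_all add: diagonal_matrices_def mat_smult_def mat_def)
      then have "D = mat_smult (D $ undefined $ undefined) (mat 1)"
        unfolding vec_eq_iff by blast
      also have "\<dots> \<in> cmat.span {mat 1}"
        by (intro cmat.span_scale cmat.span_base) simp
      finally show "D \<in> cmat.span {mat 1}" .
    qed
    then have "cmat.dim (commutant P \<inter> diagonal_matrices) \<le> card {mat 1 :: complex ^ 'n ^ 'n}"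
      by (rule cmat.dim_le_card) simp
    then show False using assms by simp
  qed
  then obtain D i j where Dc: "D \<in> commutant P" and Dd: "D \<in> diagonal_matrices"
    and ij: "D $ i $ i \<noteq> D $ j $ j" by blast
  \<comment> \<open>The spectral projection of \<open>D\<close> for the eigenvalue
    \<open>D $ i $ i\<close>. It commutes with \<open>P\<close> because \<open>P $ a $ b\<close>
    vanishes whenever \<open>D\<close> has different diagonal entries at \<open>a\<close> and
    \<open>b\<close>.\<close>
  define e :: "complex ^ 'n ^ 'n"
    where "e = (\<chi> a b. if a = b \<and> D $ a $ a = D $ i $ i then 1 else 0)"
  have ed: "e \<in> diagonal_matrices" by (simp add: e_def diagonal_matrices_def)
  have "P $ a $ b * e $ b $ b = e $ a $ a * P $ a $ b" for a b
  proof -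
    have "(P ** D) $ a $ b = (D ** P) $ a $ b" using Dc by (simp add: commutant_def)
    then have "P $ a $ b * D $ b $ b = D $ a $ a * P $ a $ b"
      unfolding diagonal_mult_left[OF Dd] diagonal_mult_right[OF Dd] .
    then have "P $ a $ b * (D $ b $ b - D $ a $ a) = 0" by (simp add: algebra_simps)
    then have "P $ a $ b = 0 \<or> D $ b $ b = D $ a $ a" by simp
    then show ?thesis unfolding e_def by (elim disjE) simp_all
  qed
  then have "e \<in> commutant P"
    by (simp add: commutant_def vec_eq_iff diagonal_mult_left[OF ed] diagonal_mult_right[OF ed])
  moreover have "e ** e = e"
    by (simp add: vec_eq_iff diagonal_mult_left[OF ed]) (simp add: e_def)
  moreover have "e $ i $ i = 1" "e $ j $ j = 0" using ij by (auto simp: e_def)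
  then have "e \<noteq> 0" "e \<noteq> mat 1" by (auto simp: mat_def)
  ultimately show thesis using that ed by blast
qed

subsection \<open>The two affine steps\<close>

text \<open>The range of \<open>q\<close> is invariant under \<open>e\<close>, hence under
  \<open>f\<close>. So both corners of \<open>q\<close> map into that range, and on it their sum
  acts as \<open>e + f\<close>, the identity.\<close>

lemma pinching:
  fixes e q :: "complex ^ 'n ^ 'n"
  assumes q: "q ** q = q" and e: "e ** e = e" and eq: "e ** q = q ** e ** q"
    and ed: "e \<in> diagonal_matrices"
  defines "f \<equiv> mat 1 - e"
  defines "p \<equiv> e ** q ** e + f ** q ** f"
  shows "p ** p = p" "q ** p = p" "p ** q = q" "e ** p = p ** e" "diag_part p = diag_part q"
proof -
  have qeq: "q ** (e ** q) = e ** q" using eq by (metis matrix_mul_assoc)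
  have qfq: "q ** (f ** q) = f ** q" by (simp add: f_def matrix_ring_simps q qeq)
  have ff: "f ** f = f" by (simp add: f_def matrix_ring_simps e)
  have ef: "e ** f = 0" "f ** e = 0" by (simp_all add: f_def matrix_ring_simps e)
  have sum: "e ** q + f ** q = q" by (simp add: f_def matrix_ring_simps)
  note assoc = matrix_mul_assoc[symmetric]
  show qp: "q ** p = p"
    by (simp add: p_def matrix_add_ldistrib assoc
        qeq[THEN matrix_mul_eq_assoc, unfolded assoc] qfq[THEN matrix_mul_eq_assoc, unfolded assoc])
  show pq: "p ** q = q"
    by (simp add: p_def matrix_plus_rdistrib assoc qeq qfq sum
        e[THEN matrix_mul_eq_assoc] ff[THEN matrix_mul_eq_assoc])
  show "p ** p = p"
    by (metis qp pq matrix_mul_assoc)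
  show "e ** p = p ** e"
    by (simp add: p_def matrix_ring_simps e ef e[THEN matrix_mul_eq_assoc]
        ef[THEN matrix_mul_eq_assoc])
  \<comment> \<open>The diagonal entries of \<open>e\<close> are 0 or 1, so each diagonal entry of
    \<open>q\<close> survives in exactly one of the two corners.\<close>
  have "e $ i $ i * e $ i $ i = e $ i $ i" for i
    using diagonal_mult_left[OF ed, of e i i] e by simp
  then have "\<forall>i. e $ i $ i = 0 \<or> e $ i $ i = 1"
    by (metis mult_cancel_left mult.right_neutral)
  moreover have fd: "f \<in> diagonal_matrices"
    using ed by (auto simp: f_def diagonal_matrices_def mat_def)
  moreover have "f $ i $ i = 1 - e $ i $ i" for i by (simp add: f_def mat_def)
  ultimately have "p $ i $ i = q $ i $ i" for i
    by (elim allE[of _ i]) (auto simp: p_def diagonal_mult_left[OF ed] diagonal_mult_right[OF ed]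
        diagonal_mult_left[OF fd] diagonal_mult_right[OF fd])
  then show "diag_part p = diag_part q" by (simp add: diag_part_def vec_eq_iff)
qed

text \<open>Stated for a general \<open>e\<close> so that it also applies with
  \<open>mat 1 - e\<close> in its place. The last two hypotheses allow a nonzero
  perturbation.\<close>

lemma strictly_smaller_commutant:
  fixes q e :: "complex ^ 'n ^ 'n"
  assumes q: "q \<in> idempotents" and p: "p \<in> idempotents"
    and qp: "q ** p = p" and pq: "p ** q = q" and ep: "e ** p = p ** e"
    and e: "e ** e = e" and ed: "e \<in> diagonal_matrices"
    and ec: "e \<in> commutant (range_projection q)"
    and pe0: "p ** e \<noteq> 0" and f0: "(mat 1 - e) ** (mat 1 - p) \<noteq> 0"
  shows "\<exists>r \<in> idempotents. diag_part r = diag_part p \<and> p ** r + r ** p = p + r \<and>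
    commutant (range_projection r) \<inter> diagonal_matrices
      \<subset> commutant (range_projection q) \<inter> diagonal_matrices"
proof -
  define f where "f = mat 1 - e"
  obtain Y where Y: "(f ** (mat 1 - p)) ** Y ** (p ** e) \<noteq> 0"
    using matrix_sandwich_nonzero[OF f0 pe0] by (auto simp: f_def)
  \<comment> \<open>\<open>N\<close> maps the part of the range of \<open>p\<close> inside the range
    of \<open>e\<close> to the part of the kernel of \<open>p\<close> inside the range of
    \<open>f\<close>.\<close>
  define N where "N = (f ** (mat 1 - p)) ** Y ** (p ** e)"
  define r where "r = p + N"
  have pp: "p ** p = p" using p by (simp add: idempotents_def)
  note s = pp e ep pp[THEN matrix_mul_eq_assoc] e[THEN matrix_mul_eq_assoc]
    ep[THEN matrix_mul_eq_assoc, unfolded matrix_mul_assoc[symmetric]]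
  have eN: "e ** N = 0" by (simp add: N_def f_def matrix_ring_simps s)
  have Ne: "N ** e = N" by (simp add: N_def f_def matrix_ring_simps s)
  have pN: "p ** N = 0" by (simp add: N_def f_def matrix_ring_simps s)
  have Np: "N ** p = N" by (simp add: N_def f_def matrix_ring_simps s)
  have NN: "N ** N = 0" by (metis Ne eN matrix_mul_assoc matrix_zero_right)
  have r: "r \<in> idempotents"
    by (simp add: r_def idempotents_def matrix_ring_simps pp pN Np NN)
  have anti: "p ** r + r ** p = p + r"
    by (simp add: r_def matrix_ring_simps pp pN Np)
  have Nii: "N $ i $ i = 0" for i
    using diagonal_mult_left[OF ed, of N i i] diagonal_mult_right[OF ed, of N i i] eN Ne
    by (metis mult_cancel_left mult_zero_left mult.commute mult.right_neutral zero_index)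
  then have diag: "diag_part r = diag_part p"
    by (simp add: r_def diag_part_def vec_eq_iff)
  have descend: "D ** q = q ** D ** q"
    if D: "D \<in> diagonal_matrices" and Dr: "D ** r = r ** D ** r" for D
  proof -
    have eD: "D ** e = e ** D" by (rule diagonal_matrices_commute[OF D ed])
    have er: "e ** r = e ** p" by (simp add: r_def matrix_ring_simps eN)
    have fp: "f ** p = p ** f" by (simp add: f_def matrix_ring_simps ep)
    have fD: "D ** f = f ** D" by (simp add: f_def matrix_ring_simps eD)
    have Nf: "N ** f = 0" by (simp add: f_def matrix_ring_simps Ne)
    have rf: "r ** f = p ** f" by (simp add: r_def matrix_ring_simps Nf)
    \<comment> \<open>Multiply the invariance of the range of \<open>r\<close> by \<open>e\<close>
      on the left; \<open>N\<close> drops out because \<open>e ** N = 0\<close>.\<close>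
    have 1: "e ** (D ** p) = e ** (p ** (D ** p))"
    proof -
      have "e ** (D ** p) = e ** (D ** r)" by (metis er eD matrix_mul_assoc)
      also have "\<dots> = (e ** r) ** (D ** r)" by (metis Dr matrix_mul_assoc)
      also have "\<dots> = p ** (e ** (D ** r))" by (simp only: er ep matrix_mul_assoc)
      also have "\<dots> = p ** (e ** (D ** p))" by (metis er eD matrix_mul_assoc)
      also have "\<dots> = e ** (p ** (D ** p))" by (simp only: ep matrix_mul_assoc)
      finally show ?thesis .
    qed
    \<comment> \<open>Multiply by \<open>f\<close> on the right; \<open>N ** f = 0\<close> removes
      \<open>N\<close> from the last factor, and moving \<open>f\<close> leftwards past
      \<open>p\<close> and \<open>D\<close> removes it from the first.\<close>
    have 2: "D ** (p ** f) = p ** (D ** (p ** f))"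
    proof -
      have "D ** (p ** f) = (D ** r) ** f" by (metis rf matrix_mul_assoc)
      also have "\<dots> = r ** (D ** (r ** f))" by (metis Dr matrix_mul_assoc)
      also have "\<dots> = r ** (f ** (D ** p))" by (metis rf fp fD matrix_mul_assoc)
      also have "\<dots> = p ** (f ** (D ** p))" by (metis rf matrix_mul_assoc)
      also have "\<dots> = p ** (D ** (p ** f))" by (metis fp fD matrix_mul_assoc)
      finally show ?thesis .
    qed
    have 3: "f ** (D ** p) = D ** (p ** f)"
      by (metis fp fD matrix_mul_assoc)
    have 4: "f ** (p ** (D ** p)) = p ** (D ** (p ** f))"
      by (metis fp fD matrix_mul_assoc)
    have "D ** p = e ** (D ** p) + f ** (D ** p)"
      by (simp add: f_def matrix_ring_simps)
    also have "\<dots> = e ** (p ** (D ** p)) + f ** (p ** (D ** p))"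
      using 1 2 3 4 by metis
    also have "\<dots> = p ** (D ** p)"
      by (simp add: f_def matrix_ring_simps)
    finally have "D ** p = p ** (D ** p)" .
    then show ?thesis by (metis pq qp matrix_mul_assoc)
  qed
  have "e \<notin> commutant (range_projection r)"
  proof
    assume "e \<in> commutant (range_projection r)"
    then have "e ** r = r ** (e ** r)"
      by (metis commutant_range_projection_iff[OF r] matrix_mul_assoc)
    \<comment> \<open>Invariance of the range of \<open>r\<close> under \<open>e\<close> fails by
      exactly \<open>N\<close>.\<close>
    then have "p ** e = p ** e + N"
      by (simp add: r_def matrix_ring_simps eN s Np Np[THEN matrix_mul_eq_assoc] Ne)
    then show False using Y by (simp add: N_def)
  qed
  moreover have "commutant (range_projection r) \<inter> diagonal_matrices
      \<subseteq> commutant (range_projection q) \<inter> diagonal_matrices"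
    using descend conj_transpose_diagonal
    unfolding commutant_range_projection_iff[OF r] commutant_range_projection_iff[OF q] subset_iff
      Int_iff
    by metis
  ultimately show ?thesis using r diag anti ec ed by blast
qed

theorem proposition7p2:
  fixes q :: "complex ^ 'n ^ 'n"
  assumes "q \<in> idempotents" and "q \<noteq> 0" and "q \<noteq> mat 1"
    and "cmat.dim (commutant (range_projection q) \<inter> diagonal_matrices) > 1"
  shows "\<exists>r \<in> idempotents.
      diag_part r = diag_part q
    \<and> commutant (range_projection r) \<inter> diagonal_matrices
        \<subset> commutant (range_projection q) \<inter> diagonal_matrices
    \<and> (\<exists>p. path_image (linepath q p +++ linepath p r)
             \<subseteq> {s \<in> idempotents. diag_part s = diag_part q})"
proof -
  obtain e where ec: "e \<in> commutant (range_projection q)" and ed: "e \<in> diagonal_matrices"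
    and e: "e ** e = e" and e0: "e \<noteq> 0" and e1: "e \<noteq> mat 1"
    using diagonal_dim_gt_1_obtains_projection[OF assms(4)] by metis
  define f where "f = mat 1 - e"
  define p where "p = e ** q ** e + f ** q ** f"
  have qq: "q ** q = q" using assms(1) by (simp add: idempotents_def)
  have eq: "e ** q = q ** e ** q"
    using ec by (simp add: commutant_range_projection_iff[OF assms(1)])
  note pinch = pinching[OF qq e eq ed, folded f_def, folded p_def]
  have p: "p \<in> idempotents" using pinch(1) by (simp add: idempotents_def)
  have f: "f ** f = f" by (simp add: f_def matrix_ring_simps e)
  have fd: "f \<in> diagonal_matrices"
    using ed by (auto simp: f_def diagonal_matrices_def mat_def)
  have fc: "f \<in> commutant (range_projection q)"
    using ec by (simp add: f_def commutant_def matrix_ring_simps)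
  have fp: "f ** p = p ** f" by (simp add: f_def matrix_ring_simps pinch(4))
  have ef: "mat 1 - f = e" by (simp add: f_def)
  \<comment> \<open>If both alternatives fail, the four cases give \<open>p = 0\<close>,
    \<open>e = 0\<close>, \<open>f = 0\<close> or \<open>p = mat 1\<close>, all excluded.\<close>
  have "(p ** e \<noteq> 0 \<and> f ** (mat 1 - p) \<noteq> 0) \<or> (p ** f \<noteq> 0 \<and> e ** (mat 1 - p) \<noteq> 0)"
  proof (rule ccontr)
    assume "\<not> ?thesis"
    then have a: "p ** e = 0 \<or> f = p ** f" and b: "p ** f = 0 \<or> e = p ** e"
      by (auto simp: matrix_ring_simps fp pinch(4))
    have sum: "p = p ** e + p ** f" by (simp add: f_def matrix_ring_simps)
    have "p \<noteq> 0" using pinch(3) assms(2) by (metis matrix_zero_left)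
    moreover have "p \<noteq> mat 1" using pinch(2) assms(3) by (metis matrix_mul_rid)
    moreover have "f \<noteq> 0" using e1 by (simp add: f_def)
    moreover have "e + f = mat 1" by (simp add: f_def)
    ultimately show False using a b sum e0 by (metis add_0)
  qed
  then obtain r where r: "r \<in> idempotents" "diag_part r = diag_part p"
      "p ** r + r ** p = p + r"
      "commutant (range_projection r) \<inter> diagonal_matrices
        \<subset> commutant (range_projection q) \<inter> diagonal_matrices"
    using strictly_smaller_commutant[OF assms(1) p pinch(2,3,4) e ed ec, folded f_def]
      strictly_smaller_commutant[OF assms(1) p pinch(2,3) fp f fd fc, unfolded ef]
    by blast
  \<comment> \<open>Having the same range, \<open>q\<close> and \<open>p\<close> satisfy
    \<open>q ** p = p\<close> and \<open>p ** q = q\<close>, which add up to the anticommutator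
    condition.\<close>
  have "path_image (linepath q p) \<subseteq> {s \<in> idempotents. diag_part s = diag_part q}"
    using segment_idempotents[OF assms(1) p _ pinch(5)] pinch(2,3) by (simp add: add.commute)
  moreover have "path_image (linepath p r) \<subseteq> {s \<in> idempotents. diag_part s = diag_part q}"
    using segment_idempotents[OF p r(1) r(3) r(2)] pinch(5) by simp
  ultimately have "path_image (linepath q p +++ linepath p r)
      \<subseteq> {s \<in> idempotents. diag_part s = diag_part q}"
    using path_image_join_subset by blast
  moreover have "diag_part r = diag_part q" using r(2) pinch(5) by simp
  ultimately show ?thesis using r(1,4) by blast
qed

end
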